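(* Let $k$ be an ordered field and let $\mathbb L=k((\mathbb Z))$ be the field of formal Laurent series over $k$ with the lexicographic order. The $k$-automorphisms of $\mathbb L$ preserving the lexicographic order are exactly the automorphisms $\sigma_u$ corresponding to positive units $u\in U^{>0}$, and \[ o\text{-}\mathrm{Aut}_k\mathbb L\simeq(U^{>0},\times_s). \] More precisely, \[ o\text{-}\mathrm{Aut}_{(k)}\mathbb L\simeq\big((1+I_{\mathbb L},\times_s)\rtimes k^{>0}\big)\rtimes o\text{-}\mathrm{Aut}\,k. \]
   Context: $\mathbb L=k((\mathbb Z))$ is the field of formal Laurent series $a=\sum_{i\ge m}a_it^i$ ($m\in\mathbb Z$, $a_i\in k$), with valuation $v(a)=\min\{i:a_i\neq0\}$ for $a\ne0$, $v(0)=\infty$. $I_{\mathbb L}=\{a:v(a)>0\}$, $U=\{a:v(a)=0\}$ is the group of units of the valuation ring, and $1+I_{\mathbb L}$ is the group of 1-units. The (total) order on $k$ induces the lexicographic order on $\mathbb L$: $a>0$ iff $a_{v(a)}>0$ in $k$. $U^{>0}$ is the set of positive elements of $U$; $k^{>0}$ is the multiplicative group of positive elements of $k$. $o\text{-}\mathrm{Aut}\,k$ and $o\text{-}\mathrm{Aut}\,\mathbb L$ are the groups of order preserving field automorphisms of $k$ and of $\mathbb L$; $o\text{-}\mathrm{Aut}_{(k)}\mathbb L$ is the subgroup of those $\sigma\in o\text{-}\mathrm{Aut}\,\mathbb L$ with $\sigma(k)=k$, and $o\text{-}\mathrm{Aut}_k\mathbb L$ the subgroup of those with $\sigma|_k=\mathrm{id}_k$.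 For $u\in U$ let $\sigma_u$ be the $k$-automorphism of $\mathbb L$ given by $\sigma_u(\sum a_it^i)=\sum a_i(ut)^i$. The operation $\times_s$ on $U$ is $u_1\times_su_2=u_1\cdot\sigma_{u_1}(u_2)$ (this is the operation for which $\sigma_{u_1\times_su_2}=\sigma_{u_1}\circ\sigma_{u_2}$); on $k^\times\subseteq U$ it coincides with multiplication. Semi-direct products are written with the normal factor on the left; the actions are induced by conjugation of automorphisms, where $u\in U$ is identified with $\sigma_u$ and $\rho\in o\text{-}\mathrm{Aut}\,k$ with $\sum a_it^i\mapsto\sum\rho(a_i)t^i$. *)

theory Defs
  imports "HOL-Computational_Algebra.Formal_Laurent_Series" "HOL-Algebra.Group"
begin

text \<open>A series is positive iff its lowest nonzero coefficient is; the zero series has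
  subdegree 0 by convention and coefficient 0 there, so it is not positive.\<close>

definition fls_pos :: "'a::linordered_field fls \<Rightarrow> bool" where
  "fls_pos f \<longleftrightarrow> fls_nth f (fls_subdegree f) > 0"

lemma not_fls_pos_0: "\<not> fls_pos 0"
  by (simp add: fls_pos_def)

lemma fls_pos_iff:
  "fls_pos f \<longleftrightarrow> (\<exists>n. fls_nth f n > 0 \<and> (\<forall>i<n. fls_nth f i = 0))"
proof
  assume "\<exists>n. fls_nth f n > 0 \<and> (\<forall>i<n. fls_nth f i = 0)"
  then obtain n where "fls_nth f n > 0" "\<forall>i<n. fls_nth f i = 0" by blast
  then have "fls_subdegree f = n" by (intro fls_subdegree_eqI) auto
  with \<open>fls_nth f n > 0\<close> show "fls_pos f" by (simp add: fls_pos_def)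
qed (auto simp: fls_pos_def)

lemma fls_pos_add:
  assumes "fls_pos f" "fls_pos g" shows "fls_pos (f + g)"
proof -
  obtain m where m: "fls_nth f m > 0" "\<forall>i<m. fls_nth f i = 0"
    using assms(1) by (auto simp: fls_pos_iff)
  obtain n where n: "fls_nth g n > 0" "\<forall>i<n. fls_nth g i = 0"
    using assms(2) by (auto simp: fls_pos_iff)
  have "fls_nth (f + g) (min m n) > 0"
    using m n by (cases m n rule: linorder_cases) (auto intro: add_pos_pos)
  moreover have "\<forall>i<min m n. fls_nth (f + g) i = 0"
    using m n by auto
  ultimately show ?thesis unfolding fls_pos_iff by blast
qed

lemma fls_pos_mult:
  assumes "fls_pos f" "fls_pos g" shows "fls_pos (f * g)"
proof -
  from assms have "f \<noteq> 0" "g \<noteq> 0" by (auto simp: fls_pos_def)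
  then show ?thesis using assms by (simp add: fls_pos_def fls_times_base)
qed

lemma fls_pos_cases: "f = 0 \<or> fls_pos f \<or> fls_pos (- f)"
  using nth_fls_subdegree_nonzero[of f] by (auto simp: fls_pos_def not_less_iff_gr_or_eq)

lemma not_fls_pos_uminus: "fls_pos f \<Longrightarrow> \<not> fls_pos (- f)"
  by (simp add: fls_pos_def)

instantiation fls :: (linordered_field) linordered_field
begin

definition less_fls :: "'a fls \<Rightarrow> 'a fls \<Rightarrow> bool" where
  "f < g \<longleftrightarrow> fls_pos (g - f)"

definition less_eq_fls :: "'a fls \<Rightarrow> 'a fls \<Rightarrow> bool" where
  "f \<le> g \<longleftrightarrow> f = g \<or> fls_pos (g - f)"

definition abs_fls :: "'a fls \<Rightarrow> 'a fls" where
  "\<bar>f :: 'a fls\<bar> = (if f < 0 then - f else f)"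

definition sgn_fls :: "'a fls \<Rightarrow> 'a fls" where
  "sgn (f :: 'a fls) = (if f = 0 then 0 else if 0 < f then 1 else - 1)"

instance
proof
  fix f g h :: "'a fls"
  show "f < g \<longleftrightarrow> f \<le> g \<and> \<not> g \<le> f"
    using not_fls_pos_uminus[of "g - f"] not_fls_pos_0
    by (auto simp: less_fls_def less_eq_fls_def)
  show "f \<le> f" by (simp add: less_eq_fls_def)
  show "f \<le> g \<Longrightarrow> g \<le> h \<Longrightarrow> f \<le> h"
    using fls_pos_add[of "g - f" "h - g"] by (auto simp: less_eq_fls_def)
  show "f \<le> g \<Longrightarrow> g \<le> f \<Longrightarrow> f = g"
    using not_fls_pos_uminus[of "g - f"] by (auto simp: less_eq_fls_def)
  show "f \<le> g \<or> g \<le> f"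
    using fls_pos_cases[of "g - f"] by (auto simp: less_eq_fls_def)
  show "f \<le> g \<Longrightarrow> h + f \<le> h + g" by (auto simp: less_eq_fls_def)
  show "f < g \<Longrightarrow> 0 < h \<Longrightarrow> h * f < h * g"
    using fls_pos_mult[of h "g - f"] by (auto simp: less_fls_def right_diff_distrib)
  show "\<bar>f\<bar> = (if f < 0 then - f else f)" by (rule abs_fls_def)
  show "sgn f = (if f = 0 then 0 else if 0 < f then 1 else - 1)" by (rule sgn_fls_def)
qed

end

definition o_Aut :: "('a::linordered_field \<Rightarrow> 'a) monoid" where
  "o_Aut = \<lparr>carrier = {f. bij f \<and> f 1 = 1 \<and> (\<forall>x y. f (x + y) = f x + f y) \<and>
                          (\<forall>x y. f (x * y) = f x * f y) \<and> mono f},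
            mult = (\<circ>), one = id\<rparr>"

text \<open>The field of coefficients, as a subfield of the field of Laurent series, is
  \<^term>\<open>range fls_const\<close>.\<close>

definition o_Aut_stab :: "('a::linordered_field fls \<Rightarrow> 'a fls) monoid" where
  "o_Aut_stab =
     o_Aut\<lparr>carrier := {f \<in> carrier o_Aut. f ` range fls_const = range fls_const}\<rparr>"

definition o_Aut_fix :: "('a::linordered_field fls \<Rightarrow> 'a fls) monoid" where
  "o_Aut_fix = o_Aut\<lparr>carrier := {f \<in> carrier o_Aut. \<forall>c. f (fls_const c) = fls_const c}\<rparr>"

definition U_fls :: "'a::linordered_field fls set" where
  "U_fls = {u. u \<noteq> 0 \<and> fls_subdegree u = 0}"

definition I_fls :: "'a::linordered_field fls set" where
  "I_fls = {a. a = 0 \<or> fls_subdegree a > 0}"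

text \<open>Substitution of \<open>u t\<close> for the variable \<open>t\<close>; for \<open>u\<close> in \<^const>\<open>U_fls\<close>
  the product \<open>u t\<close> has no principal part, so passing to \<^const>\<open>fls_regpart\<close> loses nothing.\<close>

definition sigma :: "'a::linordered_field fls \<Rightarrow> 'a fls \<Rightarrow> 'a fls" where
  "sigma u a = fls_compose_fps a (fls_regpart (u * fls_X))"

definition times_s :: "'a::linordered_field fls \<Rightarrow> 'a fls \<Rightarrow> 'a fls" where
  "times_s u v = u * sigma u v"

definition U_pos_group :: "'a::linordered_field fls monoid" where
  "U_pos_group = \<lparr>carrier = {u \<in> U_fls. u > 0}, mult = times_s, one = 1\<rparr>"

definition one_units_group :: "'a::linordered_field fls monoid" where
  "one_units_group = \<lparr>carrier = (\<lambda>a. 1 + a) ` I_fls, mult = times_s, one = 1\<rparr>"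

definition pos_group :: "'a::linordered_field monoid" where
  "pos_group = \<lparr>carrier = {c. c > 0}, mult = (*), one = 1\<rparr>"

definition coeff_map :: "('a::linordered_field \<Rightarrow> 'a) \<Rightarrow> 'a fls \<Rightarrow> 'a fls" where
  "coeff_map \<rho> a = Abs_fls (\<lambda>n. \<rho> (fls_nth a n))"

text \<open>For the maps of interest, those with \<open>\<rho> 0 = 0\<close>, the coefficient
  sequence in the definition of \<^const>\<open>coeff_map\<close> is that of a Laurent series.\<close>

lemma fls_nth_coeff_map: "\<rho> 0 = 0 \<Longrightarrow> fls_nth (coeff_map \<rho> a) n = \<rho> (fls_nth a n)"
  unfolding coeff_map_def by (subst nth_Abs_fls_lower_bound[of "fls_subdegree a"]) auto

lemma sigma_fls_X: "u \<in> U_fls \<Longrightarrow> sigma u fls_X = u * fls_X"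
  by (auto simp: sigma_def U_fls_def intro: fls_regpart_to_fls_trivial)

lemma sigma_times_s:
  assumes "u \<in> U_fls" "v \<in> U_fls"
  shows "sigma (times_s u v) = sigma u \<circ> sigma v"
proof
  fix a :: "'a fls"
  let ?G = "\<lambda>w. fls_regpart (w * fls_X) :: 'a fps"
  have G: "fps_to_fls (?G w) = w * fls_X" "?G w \<noteq> 0" "fps_nth (?G w) 0 = 0" if "w \<in> U_fls" for w
  proof -
    show *: "fps_to_fls (?G w) = w * fls_X"
      using that by (auto simp: U_fls_def intro: fls_regpart_to_fls_trivial)
    show "?G w \<noteq> 0"
    proof
      assume "?G w = 0"
      with * have "w * fls_X = 0" by simp
      with that show False by (simp add: U_fls_def)
    qed
    show "fps_nth (?G w) 0 = 0"
      using that by (simp add: U_fls_def fls_X_times_conv_shift)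
  qed
  have "fps_to_fls (fps_compose (?G v) (?G u)) = times_s u v * fls_X"
    using G[OF assms(1)] G[OF assms(2)]
    by (simp flip: fls_compose_fps_to_fls add: fls_compose_fps_mult times_s_def sigma_def mult_ac)
  then have "fps_compose (?G v) (?G u) = ?G (times_s u v)"
    by (metis fls_regpart_fps_trivial)
  then show "sigma (times_s u v) a = (sigma u \<circ> sigma v) a"
    using G[OF assms(1)] G[OF assms(2)]
    by (simp add: sigma_def fls_compose_fps_assoc)
qed

text \<open>The normal factor is on the left; \<open>\<alpha> h\<close> is the action of \<open>h\<close> on it.\<close>

definition semidirect ::
    "('n, 'p) monoid_scheme \<Rightarrow> ('h, 'q) monoid_scheme \<Rightarrow> ('h \<Rightarrow> 'n \<Rightarrow> 'n) \<Rightarrow> ('n \<times> 'h) monoid"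
  where
  "semidirect N H \<alpha> =
     \<lparr>carrier = carrier N \<times> carrier H,
      mult = (\<lambda>(n\<^sub>1, h\<^sub>1) (n\<^sub>2, h\<^sub>2). (n\<^sub>1 \<otimes>\<^bsub>N\<^esub> \<alpha> h\<^sub>1 n\<^sub>2, h\<^sub>1 \<otimes>\<^bsub>H\<^esub> h\<^sub>2)),
      one = (\<one>\<^bsub>N\<^esub>, \<one>\<^bsub>H\<^esub>)\<rparr>"

text \<open>Given identifications \<open>i\<close> and \<open>j\<close> of the elements of \<open>N\<close> and \<open>H\<close> with bijections
  of one set, \<open>conj_action N i j\<close> is the action of \<open>H\<close> on \<open>N\<close> by conjugation.\<close>

definition conj_action ::
    "('n, 'p) monoid_scheme \<Rightarrow> ('n \<Rightarrow> 'x \<Rightarrow> 'x) \<Rightarrow> ('h \<Rightarrow> 'x \<Rightarrow> 'x) \<Rightarrow> 'h \<Rightarrow> 'n \<Rightarrow> 'n"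
  where
  "conj_action N i j h n = (THE m. m \<in> carrier N \<and> i m = j h \<circ> i n \<circ> inv_into UNIV (j h))"

definition units_semidirect :: "('a::linordered_field fls \<times> 'a) monoid" where
  "units_semidirect =
     semidirect one_units_group pos_group
       (conj_action one_units_group sigma (\<lambda>c. sigma (fls_const c)))"

text \<open>The pair \<open>(w, c)\<close> in the inner semi-direct product is identified with the composition
  of the automorphisms identified with \<open>w\<close> and with \<open>c\<close>.\<close>

definition full_semidirect :: "(('a::linordered_field fls \<times> 'a) \<times> ('a \<Rightarrow> 'a)) monoid" where
  "full_semidirect =
     semidirect units_semidirect o_Aut
       (conj_action units_semidirect (\<lambda>(w, c). sigma w \<circ> sigma (fls_const c)) coeff_map)"

end

theory Submission
  imports Defs
begin

text \<open>
  Why the theorem holds. The order of \<open>L = k((t))\<close> knows the valuation ring: it is the convex hull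
  of the coefficient field \<open>k\<close> (\<open>subdegree_nonneg_iff_bounded\<close>). An order automorphism fixing
  \<open>k\<close> pointwise therefore preserves the valuation ring, in both directions, and this already
  forces it to send the uniformizer \<open>t\<close> to another uniformizer \<open>u t\<close>
  (\<open>o_Aut_fix_subdegree_X\<close>); since \<open>t > 0\<close>, the unit \<open>u\<close> is positive.

  If such an automorphism fixes \<open>t\<close>, it is continuous for the valuation and fixes all
  polynomials in \<open>t\<close>, so it is the identity (\<open>o_Aut_fix_eq_id\<close>). Hence every order automorphism
  over \<open>k\<close> is determined by its value \<open>u t\<close> at \<open>t\<close>, and it is \<open>\<sigma>\<^sub>u\<close>. Conversely
  \<open>\<sigma>\<^sub>u\<close> multiplies a leading coefficient \<open>a\<^sub>n\<close> by \<open>u\<^sub>0\<^sup>n\<close>, so it preserves the order when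
  \<open>u > 0\<close>, and it is onto because the power series \<open>u t\<close> has a compositional inverse.

  The semi-direct decompositions are both internal: the order automorphisms stabilizing \<open>k\<close> form
  a group in which every element is uniquely \<open>(\<sigma>\<^sub>w \<circ> \<sigma>\<^sub>c) \<circ> \<rho>\<close>. Here \<open>\<rho>\<close> is the restriction
  to \<open>k\<close>, applied coefficientwise, and the remaining automorphism over \<open>k\<close> is \<open>\<sigma>\<^sub>u\<close> for a
  positive unit \<open>u\<close>, which is the product of its constant term \<open>c\<close> and a 1-unit \<open>w\<close>. Each left
  factor is normalized by the right one, and this makes the abstract semi-direct product multiply
  like composition (\<open>semidirect_mult\<close>).
\<close>

section \<open>Groups of order automorphisms\<close>

lemma o_Aut_carrier_iff:
  "f \<in> carrier o_Aut \<longleftrightarrow> bij f \<and> f 1 = 1 \<and> (\<forall>x y. f (x + y) = f x + f y) \<and>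
     (\<forall>x y. f (x * y) = f x * f y) \<and> mono f"
  by (simp add: o_Aut_def)

lemma o_Aut_hom:
  fixes f :: "'a::linordered_field \<Rightarrow> 'a"
  assumes "f \<in> carrier o_Aut"
  shows o_Aut_bij: "bij f" and o_Aut_1: "f 1 = 1" and o_Aut_add: "f (x + y) = f x + f y"
    and o_Aut_mult: "f (x * y) = f x * f y" and o_Aut_mono: "x \<le> y \<Longrightarrow> f x \<le> f y"
    and o_Aut_0: "f 0 = 0" and o_Aut_uminus: "f (- x) = - f x" and o_Aut_diff: "f (x - y) = f x - f y"
    and o_Aut_eq_0_iff: "f x = 0 \<longleftrightarrow> x = 0"
    and o_Aut_pos: "0 < x \<Longrightarrow> 0 < f x"
proof -
  show bij: "bij f" and "f 1 = 1" and add: "\<And>x y. f (x + y) = f x + f y"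
    and "f (x * y) = f x * f y" and mono: "\<And>x y. x \<le> y \<Longrightarrow> f x \<le> f y"
    using assms by (auto simp: o_Aut_carrier_iff mono_def)
  show f0: "f 0 = 0" using add[of 0 0] by simp
  show um: "f (- x) = - f x" for x using add[of x "- x"] f0 by (simp add: eq_neg_iff_add_eq_0 add.commute)
  show "f (x - y) = f x - f y" using add[of x "- y"] um by simp
  show z: "f x = 0 \<longleftrightarrow> x = 0" for x using bij f0 by (metis bij_pointE)
  show "0 < x \<Longrightarrow> 0 < f x" using mono[of 0 x] f0 z[of x] by auto
qed

lemma o_Aut_comp:
  assumes "f \<in> carrier o_Aut" "g \<in> carrier o_Aut" shows "f \<circ> g \<in> carrier o_Aut"
  using assms by (auto simp: o_Aut_carrier_iff mono_def intro: bij_comp)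

lemma o_Aut_inv:
  fixes f :: "'a::linordered_field \<Rightarrow> 'a"
  assumes f: "f \<in> carrier o_Aut" shows "inv_into UNIV f \<in> carrier o_Aut"
proof -
  have bij: "bij f" using f by (rule o_Aut_bij)
  have inv_f: "inv_into UNIV f (f x) = x" and f_inv: "f (inv_into UNIV f x) = x" for x
    using bij by (simp_all add: bij_is_inj bij_is_surj surj_f_inv_f)
  have "inv_into UNIV f x \<le> inv_into UNIV f y" if "x \<le> y" for x y
  proof (rule ccontr)
    assume "\<not> inv_into UNIV f x \<le> inv_into UNIV f y"
    then have "f (inv_into UNIV f y) \<le> f (inv_into UNIV f x)" using o_Aut_mono[OF f] by simp
    then have "x = y" using that by (simp add: f_inv)
    with \<open>\<not> inv_into UNIV f x \<le> inv_into UNIV f y\<close> show False by simp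
  qed
  moreover have "inv_into UNIV f 1 = 1" using inv_f[of 1] o_Aut_1[OF f] by simp
  moreover have "inv_into UNIV f (x + y) = inv_into UNIV f x + inv_into UNIV f y" for x y
    using inv_f[of "inv_into UNIV f x + inv_into UNIV f y"] by (simp add: o_Aut_add[OF f] f_inv)
  moreover have "inv_into UNIV f (x * y) = inv_into UNIV f x * inv_into UNIV f y" for x y
    using inv_f[of "inv_into UNIV f x * inv_into UNIV f y"] by (simp add: o_Aut_mult[OF f] f_inv)
  ultimately show ?thesis using bij by (simp add: o_Aut_carrier_iff mono_def bij_imp_bij_inv)
qed

lemma o_Aut_fix_carrier_iff:
  "f \<in> carrier o_Aut_fix \<longleftrightarrow> f \<in> carrier o_Aut \<and> (\<forall>c. f (fls_const c) = fls_const c)"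
  by (simp add: o_Aut_fix_def)

lemma o_Aut_stab_carrier_iff:
  "f \<in> carrier o_Aut_stab \<longleftrightarrow> f \<in> carrier o_Aut \<and> f ` range fls_const = range fls_const"
  by (simp add: o_Aut_stab_def)

lemma o_Aut_fix_comp:
  "f \<in> carrier o_Aut_fix \<Longrightarrow> g \<in> carrier o_Aut_fix \<Longrightarrow> f \<circ> g \<in> carrier o_Aut_fix"
  by (simp add: o_Aut_fix_carrier_iff o_Aut_comp)

lemma o_Aut_fix_inv:
  assumes "f \<in> carrier o_Aut_fix" shows "inv_into UNIV f \<in> carrier o_Aut_fix"
proof -
  have "inv_into UNIV f (fls_const c) = fls_const c" for c
    using assms by (metis o_Aut_fix_carrier_iff o_Aut_bij bij_is_inj inv_f_f)
  then show ?thesis using assms by (simp add: o_Aut_fix_carrier_iff o_Aut_inv)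
qed

section \<open>The valuation ring as the convex hull of the coefficients\<close>

lemma fls_pos_iff_greater_0: "fls_pos f \<longleftrightarrow> 0 < f"
  by (simp add: less_fls_def)

lemma fls_less_iff: "f < g \<longleftrightarrow> (\<exists>n. fls_nth (g - f) n > 0 \<and> (\<forall>i<n. fls_nth (g - f) i = 0))"
  unfolding less_fls_def by (rule fls_pos_iff)

lemma fls_X_pos: "0 < (fls_X :: 'a::linordered_field fls)"
  by (auto simp: fls_less_iff intro!: exI[of _ 1])

lemma fls_const_pos: "0 < c \<Longrightarrow> 0 < fls_const (c :: 'a::linordered_field)"
  by (auto simp: fls_less_iff intro!: exI[of _ 0])

text \<open>A series with a pole exceeds every constant in absolute value, because the comparison is
  already decided at the negative exponent.\<close>

lemma subdegree_nonneg_iff_bounded: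
  fixes a :: "'a::linordered_field fls"
  shows "0 \<le> fls_subdegree a \<longleftrightarrow> (\<exists>c. - fls_const c \<le> a \<and> a \<le> fls_const c)"
proof
  assume nonneg: "0 \<le> fls_subdegree a"
  define c where "c = \<bar>fls_nth a 0\<bar> + 1"
  have "- c < fls_nth a 0" "fls_nth a 0 < c" by (auto simp: c_def)
  then have "- fls_const c < a" "a < fls_const c"
    using nonneg unfolding fls_less_iff by (auto intro!: exI[of _ 0])
  then show "\<exists>c. - fls_const c \<le> a \<and> a \<le> fls_const c" by (auto intro: less_imp_le)
next
  assume "\<exists>c. - fls_const c \<le> a \<and> a \<le> fls_const c"
  then obtain c where c: "- fls_const c \<le> a" "a \<le> fls_const c" by blast
  show "0 \<le> fls_subdegree a"
  proof (rule ccontr)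
    assume neg: "\<not> 0 \<le> fls_subdegree a"
    then have "a \<noteq> 0" by auto
    then have "fls_nth a (fls_subdegree a) > 0 \<or> fls_nth a (fls_subdegree a) < 0"
      using nth_fls_subdegree_nonzero[of a] by (metis neq_iff)
    then have "fls_const c < a \<or> a < - fls_const c"
      using neg unfolding fls_less_iff by (auto intro!: exI[of _ "fls_subdegree a"])
    with c show False by auto
  qed
qed

lemma o_Aut_fix_subdegree_nonneg_iff:
  assumes f: "f \<in> carrier o_Aut_fix"
  shows "0 \<le> fls_subdegree (f a) \<longleftrightarrow> 0 \<le> fls_subdegree a"
proof -
  have mono: "0 \<le> fls_subdegree (g b)" if g: "g \<in> carrier o_Aut_fix" and b: "0 \<le> fls_subdegree b"
    for g b
  proof -
    from g have g': "g \<in> carrier o_Aut" "\<And>c. g (fls_const c) = fls_const c"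
      by (auto simp: o_Aut_fix_carrier_iff)
    from b obtain c where "- fls_const c \<le> b" "b \<le> fls_const c"
      by (auto simp: subdegree_nonneg_iff_bounded)
    then have "- fls_const c \<le> g b" "g b \<le> fls_const c"
      using o_Aut_mono[OF g'(1)] by (metis g' o_Aut_uminus)+
    then show ?thesis by (auto simp: subdegree_nonneg_iff_bounded)
  qed
  have "inv_into UNIV f (f a) = a"
    using f by (simp add: o_Aut_fix_carrier_iff o_Aut_bij bij_is_inj)
  then show ?thesis using mono[OF f, of a] mono[OF o_Aut_fix_inv[OF f], of "f a"] by auto
qed

text \<open>The uniformizers are the generators of the maximal ideal of the valuation ring, so an
  automorphism preserving that ring permutes them.\<close>

lemma o_Aut_fix_subdegree_X:
  assumes f: "f \<in> carrier o_Aut_fix"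
  shows "fls_subdegree (f fls_X) = 1"
proof -
  have f': "f \<in> carrier o_Aut" using f by (simp add: o_Aut_fix_carrier_iff)
  have inv_mem: "fls_subdegree (inverse (f fls_X)) < 0"
  proof -
    have "f (inverse fls_X) * f fls_X = 1"
      by (simp flip: o_Aut_mult[OF f'] add: o_Aut_1[OF f'] del: fls_inverse_X)
    then have "inverse (f fls_X) = f (inverse fls_X)"
      by (metis inverse_unique mult.commute)
    then show ?thesis
      using o_Aut_fix_subdegree_nonneg_iff[OF f, of "inverse fls_X"] by simp
  qed
  have nz: "f fls_X \<noteq> 0" using o_Aut_eq_0_iff[OF f'] by simp
  then have pos: "0 < fls_subdegree (f fls_X)" using inv_mem by simp
  \<comment> \<open>The preimage of \<open>t\<close> lies in the maximal ideal, so it is \<open>t d\<close> with \<open>d\<close> integral;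
    applying \<open>f\<close> shows that \<open>f t\<close> divides \<open>t\<close>.\<close>
  define b where "b = inv_into UNIV f fls_X"
  have fb: "f b = fls_X"
    using f' by (simp add: b_def o_Aut_bij bij_is_surj surj_f_inv_f)
  then have bnz: "b \<noteq> 0" using o_Aut_0[OF f'] by auto
  have "f (inverse b) * f b = 1"
    using bnz by (simp flip: o_Aut_mult[OF f'] add: o_Aut_1[OF f'])
  then have "f (inverse b) = inverse fls_X"
    unfolding fb by (metis inverse_unique mult.commute)
  then have "fls_subdegree (inverse b) < 0"
    using o_Aut_fix_subdegree_nonneg_iff[OF f, of "inverse b"] by simp
  then have bpos: "0 < fls_subdegree b" using bnz by simp
  define d where "d = b / fls_X"
  have b: "b = fls_X * d"
    unfolding d_def times_divide_eq_right by (rule nonzero_mult_div_cancel_left[symmetric]) simp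
  with bnz have dnz: "d \<noteq> 0" by auto
  have "0 \<le> fls_subdegree d" using bpos dnz by (simp add: b)
  then have "0 \<le> fls_subdegree (f d)" using o_Aut_fix_subdegree_nonneg_iff[OF f] by simp
  moreover have "fls_X = f fls_X * f d" using fb by (simp add: b o_Aut_mult[OF f'])
  then have "1 = fls_subdegree (f fls_X) + fls_subdegree (f d)"
    using fls_subdegree_mult[of "f fls_X" "f d"] nz dnz o_Aut_eq_0_iff[OF f']
    by (metis fls_X_subdegree)
  ultimately show ?thesis using pos by simp
qed

section \<open>Automorphisms over the coefficients are determined by the image of the variable\<close>

text \<open>Splitting off the constant term and then a factor \<open>t\<close> turns \<open>f a - a\<close> into
  \<open>t (f a' - a')\<close> with \<open>a'\<close> again integral. Hence \<open>f a - a\<close> has arbitrarily large valuation.\<close>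

lemma o_Aut_fix_eq_id:
  assumes f: "f \<in> carrier o_Aut_fix" and X: "f fls_X = fls_X"
  shows "f = id"
proof -
  have f': "f \<in> carrier o_Aut" and const: "\<And>c. f (fls_const c) = fls_const c"
    using f by (auto simp: o_Aut_fix_carrier_iff)
  have divide: "\<exists>a'. 0 \<le> fls_subdegree a' \<and> f a - a = fls_X ^ n * (f a' - a')"
    if "0 \<le> fls_subdegree a" for a n
  proof (induction n)
    case 0
    then show ?case using that by (auto intro!: exI[of _ a])
  next
    case (Suc n)
    then obtain a' where a': "0 \<le> fls_subdegree a'" "f a - a = fls_X ^ n * (f a' - a')" by blast
    define a'' where "a'' = fls_shift 1 (a' - fls_const (fls_nth a' 0))"
    have split: "a' = fls_const (fls_nth a' 0) + fls_X * a''"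
      by (simp add: a''_def fls_X_times_conv_shift)
    have "fls_nth a'' i = 0" if "i < 0" for i
      using a'(1) that by (cases "i = - 1") (auto simp: a''_def)
    then have "0 \<le> fls_subdegree a''" by (rule fls_subdegree_ge0I)
    moreover have "f a' - a' = fls_X * (f a'' - a'')"
      by (subst (1 2) split) (simp add: o_Aut_add[OF f'] o_Aut_mult[OF f'] const X algebra_simps)
    ultimately show ?case using a'(2) by (auto simp: mult_ac)
  qed
  have fixed: "f a = a" if a: "0 \<le> fls_subdegree a" for a
  proof (rule ccontr)
    assume "f a \<noteq> a"
    define n where "n = Suc (nat (fls_subdegree (f a - a)))"
    obtain a' where a': "0 \<le> fls_subdegree a'" "f a - a = fls_X ^ n * (f a' - a')"
      using divide[OF a] by blast
    have nz: "f a' - a' \<noteq> 0" using \<open>f a \<noteq> a\<close> a'(2) by auto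
    have "0 \<le> fls_subdegree (f a')" using a'(1) o_Aut_fix_subdegree_nonneg_iff[OF f] by simp
    then have "0 \<le> fls_subdegree (f a' - a')" using fls_subdegree_minus[OF nz] a'(1) by simp
    then have "int n \<le> fls_subdegree (f a - a)"
      using nz by (simp add: a'(2) fls_subdegree_pow)
    then show False by (auto simp: n_def split: if_splits)
  qed
  show "f = id"
  proof
    fix a :: "'a fls"
    define n where "n = nat (- fls_subdegree a)"
    have "0 \<le> fls_subdegree (fls_X ^ n * a)"
      by (cases "a = 0") (auto simp: n_def fls_subdegree_pow)
    then have "f (fls_X ^ n * a) = fls_X ^ n * a" by (rule fixed)
    moreover have "f (fls_X ^ n) = fls_X ^ n" by (rule fixed) (simp add: fls_subdegree_pow)
    ultimately show "f a = id a" by (simp add: o_Aut_mult[OF f'])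
  qed
qed

lemma o_Aut_fix_eqI:
  assumes f: "f \<in> carrier o_Aut_fix" and g: "g \<in> carrier o_Aut_fix" and X: "f fls_X = g fls_X"
  shows "f = g"
proof -
  have bij: "bij g" using g by (simp add: o_Aut_fix_carrier_iff o_Aut_bij)
  have "inv_into UNIV g \<circ> f = id"
    using o_Aut_fix_comp[OF o_Aut_fix_inv[OF g] f] X bij
    by (intro o_Aut_fix_eq_id) (simp_all add: bij_is_inj)
  then have "g \<circ> (inv_into UNIV g \<circ> f) = g" by simp
  then show ?thesis using bij by (simp add: fun_eq_iff bij_is_surj surj_f_inv_f)
qed

section \<open>Substitutions by positive units\<close>

lemma sigma_fps:
  fixes u :: "'a::linordered_field fls"
  assumes "u \<in> U_fls" and G_def: "G = fls_regpart (u * fls_X)"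
  shows sigma_fps_fls: "fps_to_fls G = u * fls_X" and sigma_fps_nonzero: "G \<noteq> 0"
    and sigma_fps_0: "fps_nth G 0 = 0" and sigma_fps_1: "fps_nth G 1 \<noteq> 0"
proof -
  show *: "fps_to_fls G = u * fls_X"
    using assms by (auto simp: U_fls_def)
  show "fps_nth G 1 \<noteq> 0"
    using assms nth_fls_subdegree_nonzero[of u]
    by (auto simp: U_fls_def fls_X_times_conv_shift)
  then show "G \<noteq> 0" by auto
  show "fps_nth G 0 = 0" using assms by (simp add: U_fls_def fls_X_times_conv_shift)
qed

lemma sigma_hom:
  assumes u: "u \<in> U_fls"
  shows sigma_add: "sigma u (a + b) = sigma u a + sigma u b"
    and sigma_diff: "sigma u (a - b) = sigma u a - sigma u b"
    and sigma_mult: "sigma u (a * b) = sigma u a * sigma u b"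
    and sigma_eq_0_iff: "sigma u a = 0 \<longleftrightarrow> a = 0"
  using sigma_fps[OF u refl]
  by (simp_all add: sigma_def fls_compose_fps_add fls_compose_fps_diff fls_compose_fps_mult
      fls_compose_fps_eq_0_iff)

lemma sigma_const [simp]: "sigma u (fls_const c) = fls_const c"
  by (simp add: sigma_def)

lemma sigma_1 [simp]: "sigma u 1 = 1"
  by (simp add: sigma_def)

lemma surj_sigma:
  fixes u :: "'a::linordered_field fls"
  assumes u: "u \<in> U_fls" shows "surj (sigma u)"
proof (rule surjI)
  fix a :: "'a fls"
  define G where "G = fls_regpart (u * fls_X)"
  note G = sigma_fps[OF u G_def]
  have inv: "fps_compose (fps_inv G) G = fps_X" by (rule fps_inv) (use G in auto)
  then have "fps_inv G \<noteq> 0" by auto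
  moreover have "fps_nth (fps_inv G) 0 = 0" by (simp add: fps_inv_def)
  moreover have "fls_compose_fps a fps_X = a"
    using fls_nth_fls_compose_fps_linear[of "1::'a" a] by (intro fls_eqI) simp
  ultimately show "sigma u (fls_compose_fps a (fps_inv G)) = a"
    using G by (simp add: sigma_def fls_compose_fps_assoc inv flip: G_def)
qed

lemma sigma_pos:
  assumes u: "u \<in> U_fls" "0 < u" and a: "0 < a"
  shows "0 < sigma u a"
proof -
  define G where "G = fls_regpart (u * fls_X)"
  note G = sigma_fps[OF u(1) G_def]
  \<comment> \<open>Write \<open>a = t\<^sup>n b\<close> with \<open>b\<^sub>0 = a\<^sub>n > 0\<close>: substitution keeps \<open>b\<^sub>0\<close> and turns \<open>t\<^sup>n\<close>
    into the positive element \<open>(u t)\<^sup>n\<close>.\<close>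
  define p where "p = fps_compose (fls_base_factor_to_fps a) G"
  have "fps_nth p 0 > 0"
    using a by (simp add: p_def fps_compose_nth flip: fls_pos_iff_greater_0) (simp add: fls_pos_def)
  then have "0 < fps_to_fls p" unfolding fls_less_iff by (auto intro!: exI[of _ 0])
  moreover have "0 < fps_to_fls G" unfolding G(1) using u(2) fls_X_pos by (rule mult_pos_pos)
  then have "0 < fps_to_fls G powi fls_subdegree a" by (rule zero_less_power_int)
  ultimately show ?thesis
    by (simp add: sigma_def fls_compose_fps_def p_def flip: G_def)
qed

lemma sigma_in_o_Aut_fix:
  assumes u: "u \<in> U_fls" "0 < u"
  shows "sigma u \<in> carrier o_Aut_fix"
proof -
  have "inj (sigma u)"
    using sigma_diff[OF u(1)] sigma_eq_0_iff[OF u(1)] by (metis injI right_minus_eq)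
  then have "bij (sigma u)" using surj_sigma[OF u(1)] by (simp add: bij_def)
  moreover have "sigma u a \<le> sigma u b" if "a \<le> b" for a b
    using that sigma_pos[OF u, of "b - a"] by (cases "a = b") (auto simp: sigma_diff[OF u(1)])
  ultimately show ?thesis
    using u by (simp add: o_Aut_fix_carrier_iff o_Aut_carrier_iff mono_def sigma_add sigma_mult)
qed

lemma o_Aut_fix_carrier_eq: "carrier o_Aut_fix = sigma ` {u \<in> U_fls. u > 0}"
proof (intro equalityI subsetI)
  fix f :: "'a fls \<Rightarrow> 'a fls" assume f: "f \<in> carrier o_Aut_fix"
  then have f': "f \<in> carrier o_Aut" by (simp add: o_Aut_fix_carrier_iff)
  define u where "u = f fls_X / fls_X"
  have fX: "f fls_X = u * fls_X"
    unfolding u_def times_divide_eq_left by (rule nonzero_mult_div_cancel_right[symmetric]) simp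
  have "0 < u" unfolding u_def by (intro divide_pos_pos o_Aut_pos[OF f'] fls_X_pos)
  moreover from this have "fls_subdegree u = 0"
    using o_Aut_fix_subdegree_X[OF f] by (simp add: fX)
  ultimately have u: "u \<in> {u \<in> U_fls. u > 0}" by (auto simp: U_fls_def)
  then have "f = sigma u"
    using f by (intro o_Aut_fix_eqI sigma_in_o_Aut_fix) (auto simp: fX sigma_fls_X)
  then show "f \<in> sigma ` {u \<in> U_fls. u > 0}" using u by blast
qed (auto intro: sigma_in_o_Aut_fix)

lemma inj_on_sigma: "inj_on sigma U_fls"
proof (rule inj_onI)
  fix u v :: "'a fls" assume "u \<in> U_fls" "v \<in> U_fls" "sigma u = sigma v"
  then have "u * fls_X = v * fls_X" by (metis sigma_fls_X)
  then show "u = v" by simp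
qed

text \<open>Closure is read off from the automorphism \<open>\<sigma>\<^sub>u \<circ> \<sigma>\<^sub>v\<close> and not computed on series.\<close>

lemma times_s_U_pos:
  assumes u: "u \<in> U_fls" "0 < u" and v: "v \<in> U_fls" "0 < v"
  shows "times_s u v \<in> U_fls" "0 < times_s u v"
proof -
  have "sigma u \<circ> sigma v \<in> carrier o_Aut_fix"
    using u v by (intro o_Aut_fix_comp sigma_in_o_Aut_fix)
  then obtain w where w: "w \<in> U_fls" "0 < w" "sigma u \<circ> sigma v = sigma w"
    by (auto simp: o_Aut_fix_carrier_eq)
  have "w * fls_X = (sigma u \<circ> sigma v) fls_X" using w by (simp add: sigma_fls_X)
  also have "\<dots> = times_s u v * fls_X"
    using u v by (simp add: sigma_fls_X sigma_mult times_s_def mult_ac)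
  finally have "w = times_s u v" by simp
  with w show "times_s u v \<in> U_fls" "0 < times_s u v" by simp_all
qed

section \<open>Semi-direct products of groups of bijections\<close>

text \<open>The value of the conjugation action is a definite description; normality supplies existence
  and injectivity of \<open>i\<close> supplies uniqueness.\<close>

lemma conj_action_eqI:
  assumes "inj_on i (carrier N)" and m: "m \<in> carrier N" and j: "bij (j h)"
    and comm: "i m \<circ> j h = j h \<circ> i n"
  shows "conj_action N i j h n = m"
proof -
  have "j h \<circ> i n \<circ> inv_into UNIV (j h) = i m \<circ> (j h \<circ> inv_into UNIV (j h))"
    by (simp add: o_assoc comm)
  also have "j h \<circ> inv_into UNIV (j h) = id" using bij_is_surj[OF j] by (simp only: surj_iff)
  also have "i m \<circ> id = i m" by simp
  finally have conj: "i m = j h \<circ> i n \<circ> inv_into UNIV (j h)" by (rule sym)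
  show ?thesis
    unfolding conj_action_def
  proof (rule the_equality)
    show "m \<in> carrier N \<and> i m = j h \<circ> i n \<circ> inv_into UNIV (j h)" using m conj by blast
    show "m' = m" if "m' \<in> carrier N \<and> i m' = j h \<circ> i n \<circ> inv_into UNIV (j h)" for m'
      using that m conj inj_onD[OF assms(1), of m' m] by (metis (no_types))
  qed
qed

text \<open>In \<open>i n\<^sub>1 \<circ> j h\<^sub>1 \<circ> i n\<^sub>2 \<circ> j h\<^sub>2\<close> the conjugation action is exactly what moves
  \<open>j h\<^sub>1\<close> past \<open>i n\<^sub>2\<close>.\<close>

lemma semidirect_mult:
  fixes i :: "'n \<Rightarrow> 'x \<Rightarrow> 'x" and j :: "'h \<Rightarrow> 'x \<Rightarrow> 'x"
  assumes inj: "inj_on i (carrier N)"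
    and N: "\<And>m n. m \<in> carrier N \<Longrightarrow> n \<in> carrier N \<Longrightarrow>
              m \<otimes>\<^bsub>N\<^esub> n \<in> carrier N \<and> i (m \<otimes>\<^bsub>N\<^esub> n) = i m \<circ> i n"
    and bij: "\<And>h. h \<in> carrier H \<Longrightarrow> bij (j h)"
    and H: "\<And>g h. g \<in> carrier H \<Longrightarrow> h \<in> carrier H \<Longrightarrow>
              g \<otimes>\<^bsub>H\<^esub> h \<in> carrier H \<and> j (g \<otimes>\<^bsub>H\<^esub> h) = j g \<circ> j h"
    and normal: "\<And>h n. h \<in> carrier H \<Longrightarrow> n \<in> carrier N \<Longrightarrow>
                   \<exists>m\<in>carrier N. i m \<circ> j h = j h \<circ> i n"
  defines "S \<equiv> semidirect N H (conj_action N i j)" and "\<phi> \<equiv> \<lambda>(n, h). i n \<circ> j h"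
  assumes x: "x \<in> carrier S" and y: "y \<in> carrier S"
  shows "x \<otimes>\<^bsub>S\<^esub> y \<in> carrier S \<and> \<phi> (x \<otimes>\<^bsub>S\<^esub> y) = \<phi> x \<circ> \<phi> y"
proof -
  obtain n\<^sub>1 h\<^sub>1 where x': "x = (n\<^sub>1, h\<^sub>1)" "n\<^sub>1 \<in> carrier N" "h\<^sub>1 \<in> carrier H"
    using x by (auto simp: S_def semidirect_def)
  obtain n\<^sub>2 h\<^sub>2 where y': "y = (n\<^sub>2, h\<^sub>2)" "n\<^sub>2 \<in> carrier N" "h\<^sub>2 \<in> carrier H"
    using y by (auto simp: S_def semidirect_def)
  obtain m where m: "m \<in> carrier N" "i m \<circ> j h\<^sub>1 = j h\<^sub>1 \<circ> i n\<^sub>2"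
    using normal x' y' by blast
  have "x \<otimes>\<^bsub>S\<^esub> y = (n\<^sub>1 \<otimes>\<^bsub>N\<^esub> m, h\<^sub>1 \<otimes>\<^bsub>H\<^esub> h\<^sub>2)"
    using conj_action_eqI[of i N m j h\<^sub>1 n\<^sub>2] inj bij m x'(3)
    by (simp add: S_def semidirect_def x' y')
  moreover have "i n\<^sub>1 \<circ> i m \<circ> (j h\<^sub>1 \<circ> j h\<^sub>2) = i n\<^sub>1 \<circ> j h\<^sub>1 \<circ> (i n\<^sub>2 \<circ> j h\<^sub>2)"
    using m(2) by (simp add: fun_eq_iff)
  ultimately show ?thesis
    using N[OF x'(2) m(1)] H[OF x'(3) y'(3)] by (simp add: S_def semidirect_def \<phi>_def x' y')
qed

lemma is_iso_by_parametrization: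
  assumes bij: "bij_betw \<phi> (carrier G) (carrier A)"
    and mult: "\<And>x y. x \<in> carrier G \<Longrightarrow> y \<in> carrier G \<Longrightarrow>
                 x \<otimes>\<^bsub>G\<^esub> y \<in> carrier G \<and> \<phi> (x \<otimes>\<^bsub>G\<^esub> y) = \<phi> x \<otimes>\<^bsub>A\<^esub> \<phi> y"
  shows "A \<cong> G"
proof -
  define \<psi> where "\<psi> = inv_into (carrier G) \<phi>"
  have \<psi>: "bij_betw \<psi> (carrier A) (carrier G)"
    unfolding \<psi>_def using bij by (rule bij_betw_inv_into)
  moreover have "\<psi> (a \<otimes>\<^bsub>A\<^esub> b) = \<psi> a \<otimes>\<^bsub>G\<^esub> \<psi> b" if ab: "a \<in> carrier A" "b \<in> carrier A" for a b
  proof -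
    have mem: "\<psi> a \<in> carrier G" "\<psi> b \<in> carrier G" using ab \<psi> by (auto dest: bij_betwE)
    have "\<phi> (\<psi> a) = a" "\<phi> (\<psi> b) = b"
      using ab bij unfolding \<psi>_def by (simp_all add: bij_betw_inv_into_right)
    then have "a \<otimes>\<^bsub>A\<^esub> b = \<phi> (\<psi> a \<otimes>\<^bsub>G\<^esub> \<psi> b)" using mult[OF mem] by simp
    moreover have "\<psi> (\<phi> z) = z" if "z \<in> carrier G" for z
      using that bij unfolding \<psi>_def by (simp add: bij_betw_inv_into_left)
    ultimately show ?thesis using mult[OF mem] by metis
  qed
  ultimately have "\<psi> \<in> iso A G" by (auto simp: iso_def hom_def dest: bij_betwE)
  then show ?thesis by (rule is_isoI)
qed

section \<open>Positive units as products of 1-units and positive constants\<close>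

lemma fls_const_U_pos:
  "0 < c \<Longrightarrow> fls_const c \<in> U_fls" "0 < c \<Longrightarrow> 0 < fls_const (c :: 'a::linordered_field)"
  by (auto simp: U_fls_def fls_const_pos)

lemma U_pos_iff:
  fixes u :: "'a::linordered_field fls"
  shows "u \<in> U_fls \<and> 0 < u \<longleftrightarrow> (\<forall>i<0. fls_nth u i = 0) \<and> 0 < fls_nth u 0"
proof
  assume "u \<in> U_fls \<and> 0 < u"
  then show "(\<forall>i<0. fls_nth u i = 0) \<and> 0 < fls_nth u 0"
    by (auto simp: U_fls_def fls_pos_def simp flip: fls_pos_iff_greater_0)
next
  assume *: "(\<forall>i<0. fls_nth u i = 0) \<and> 0 < fls_nth u 0"
  then have "fls_subdegree u = 0" by (intro fls_subdegree_eqI) auto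
  then show "u \<in> U_fls \<and> 0 < u"
    using * by (auto simp: U_fls_def fls_pos_def simp flip: fls_pos_iff_greater_0)
qed

lemma I_fls_iff: "a \<in> I_fls \<longleftrightarrow> (\<forall>i\<le>0. fls_nth a i = 0)"
  by (auto simp: I_fls_def intro: fls_subdegree_greaterI)

lemma one_units_iff:
  fixes w :: "'a::linordered_field fls"
  shows "w \<in> carrier one_units_group \<longleftrightarrow> w \<in> U_fls \<and> 0 < w \<and> fls_nth w 0 = 1"
proof -
  have "w \<in> carrier one_units_group \<longleftrightarrow> w - 1 \<in> I_fls"
    by (force simp: one_units_group_def image_iff)
  also have "\<dots> \<longleftrightarrow> (\<forall>i\<le>0. fls_nth (w - 1) i = 0)" by (rule I_fls_iff)
  also have "\<dots> \<longleftrightarrow> (\<forall>i<0. fls_nth w i = 0) \<and> fls_nth w 0 = 1"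
    by (auto simp: le_less)
  also have "\<dots> \<longleftrightarrow> w \<in> U_fls \<and> 0 < w \<and> fls_nth w 0 = 1"
    using U_pos_iff[of w] by auto
  finally show ?thesis .
qed

lemma fls_nth_0_mult:
  assumes "u \<in> U_fls" "v \<in> U_fls" shows "fls_nth (u * v) 0 = fls_nth u 0 * fls_nth v 0"
proof -
  have "fls_subdegree u = 0" "fls_subdegree v = 0" using assms by (auto simp: U_fls_def)
  from fls_times_base[of u v, unfolded this] show ?thesis by (simp only: add_0)
qed

lemma fls_nth_0_sigma:
  assumes u: "u \<in> U_fls" and v: "v \<in> U_fls"
  shows "sigma u v \<in> U_fls" "fls_nth (sigma u v) 0 = fls_nth v 0"
proof -
  define G where "G = fls_regpart (u * fls_X)"
  note G = sigma_fps[OF u G_def]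
  have "fls_subdegree (sigma u v) = 0"
    using G v by (simp add: sigma_def U_fls_def flip: G_def)
  then show "sigma u v \<in> U_fls" using v sigma_eq_0_iff[OF u] by (simp add: U_fls_def)
  show "fls_nth (sigma u v) 0 = fls_nth v 0"
    using v by (simp add: sigma_def fls_compose_fps_def U_fls_def fps_compose_nth)
qed

lemma times_s_const: "times_s w (fls_const c) = w * fls_const c"
  by (simp add: times_s_def)

lemma one_units_mult:
  assumes "w \<in> carrier one_units_group" "z \<in> carrier one_units_group"
  shows "w \<otimes>\<^bsub>one_units_group\<^esub> z \<in> carrier one_units_group \<and>
         sigma (w \<otimes>\<^bsub>one_units_group\<^esub> z) = sigma w \<circ> sigma z"
proof -
  have m: "w \<otimes>\<^bsub>one_units_group\<^esub> z = times_s w z" by (simp add: one_units_group_def)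
  have wz: "w \<in> U_fls" "0 < w" "fls_nth w 0 = 1" "z \<in> U_fls" "0 < z" "fls_nth z 0 = 1"
    using assms by (simp_all add: one_units_iff)
  have "fls_nth (times_s w z) 0 = 1"
    using wz by (simp add: times_s_def fls_nth_0_mult fls_nth_0_sigma)
  then show ?thesis
    unfolding m one_units_iff using wz times_s_U_pos[of w z] by (simp add: sigma_times_s)
qed

lemma pos_group_mult:
  fixes c d :: "'a::linordered_field"
  assumes "c \<in> carrier pos_group" "d \<in> carrier pos_group"
  shows "c \<otimes>\<^bsub>pos_group\<^esub> d \<in> carrier pos_group \<and>
    sigma (fls_const (c \<otimes>\<^bsub>pos_group\<^esub> d)) = sigma (fls_const c) \<circ> sigma (fls_const d)"
proof -
  have "times_s (fls_const c) (fls_const d) = fls_const (c * d)"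
    by (simp add: times_s_const)
  then have "sigma (fls_const (c * d)) = sigma (fls_const c) \<circ> sigma (fls_const d)"
    using assms by (metis sigma_times_s fls_const_U_pos(1) pos_group_def mem_Collect_eq
        partial_object.select_convs(1))
  then show ?thesis using assms by (simp add: pos_group_def)
qed

text \<open>Since constants are fixed, \<open>c \<times>\<^sub>s w = c \<sigma>\<^sub>c(w) = \<sigma>\<^sub>c(w) \<times>\<^sub>s c\<close>: conjugation by
  \<open>\<sigma>\<^sub>c\<close> sends \<open>\<sigma>\<^sub>w\<close> to the automorphism of the 1-unit \<open>\<sigma>\<^sub>c(w)\<close>.\<close>

lemma pos_group_normalizes_one_units:
  fixes c :: "'a::linordered_field"
  assumes c: "c \<in> carrier pos_group" and w: "w \<in> carrier one_units_group"
  shows "\<exists>z\<in>carrier one_units_group. sigma z \<circ> sigma (fls_const c) = sigma (fls_const c) \<circ> sigma w"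
proof -
  have c': "fls_const c \<in> U_fls" "0 < fls_const c"
    using c fls_const_U_pos by (auto simp: pos_group_def)
  have w': "w \<in> U_fls" "0 < w" "fls_nth w 0 = 1" using w by (simp_all add: one_units_iff)
  let ?z = "sigma (fls_const c) w"
  have z: "?z \<in> carrier one_units_group"
    using fls_nth_0_sigma[OF c'(1) w'(1)] sigma_pos[OF c' w'(2)] w'(3) by (simp add: one_units_iff)
  have "sigma ?z \<circ> sigma (fls_const c) = sigma (times_s ?z (fls_const c))"
    using z c' by (simp add: one_units_iff sigma_times_s)
  also have "times_s ?z (fls_const c) = times_s (fls_const c) w"
    by (simp add: times_s_def mult.commute)
  also have "sigma \<dots> = sigma (fls_const c) \<circ> sigma w"
    using c' w' by (simp add: sigma_times_s)
  finally show ?thesis using z by blast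
qed

lemma units_semidirect_carrier:
  "carrier units_semidirect = carrier one_units_group \<times> {c. 0 < c}"
  by (simp add: units_semidirect_def semidirect_def pos_group_def)

lemma one_units_subset: "carrier one_units_group \<subseteq> U_fls"
  by (auto simp: one_units_iff)

lemma units_semidirect_mult:
  fixes x y :: "'a::linordered_field fls \<times> 'a"
  defines "\<phi> \<equiv> \<lambda>(w, c). sigma w \<circ> sigma (fls_const c)"
  assumes "x \<in> carrier units_semidirect" "y \<in> carrier units_semidirect"
  shows "x \<otimes>\<^bsub>units_semidirect\<^esub> y \<in> carrier units_semidirect \<and>
         \<phi> (x \<otimes>\<^bsub>units_semidirect\<^esub> y) = \<phi> x \<circ> \<phi> y"
  unfolding units_semidirect_def \<phi>_def
proof (rule semidirect_mult)
  show "inj_on sigma (carrier one_units_group)"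
    using inj_on_sigma one_units_subset by (rule inj_on_subset)
  show "bij (sigma (fls_const c))" if "c \<in> carrier pos_group" for c :: 'a
    using that sigma_in_o_Aut_fix fls_const_U_pos
    by (auto simp: pos_group_def o_Aut_fix_carrier_iff intro: o_Aut_bij)
qed (use assms in \<open>auto simp: units_semidirect_def one_units_mult pos_group_mult
      pos_group_normalizes_one_units\<close>)

lemma units_semidirect_param:
  "bij_betw (\<lambda>(w, c). sigma w \<circ> sigma (fls_const c)) (carrier units_semidirect)
     (carrier (o_Aut_fix :: ('a::linordered_field fls \<Rightarrow> 'a fls) monoid))"
proof -
  let ?P = "{u \<in> U_fls. u > 0} :: 'a fls set"
  let ?\<mu> = "\<lambda>(w, c). w * fls_const c :: 'a fls"
  have product: "w * fls_const c \<in> ?P" "fls_nth (w * fls_const c) 0 = c"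
    if "(w, c) \<in> carrier units_semidirect" for w :: "'a fls" and c
  proof -
    have w: "w \<in> U_fls" "0 < w" "fls_nth w 0 = 1" and c: "0 < c"
      using that by (auto simp: units_semidirect_carrier one_units_iff)
    show "w * fls_const c \<in> ?P"
      using times_s_U_pos[OF w(1,2) fls_const_U_pos[OF c]] by (simp add: times_s_const)
    show "fls_nth (w * fls_const c) 0 = c" using w by simp
  qed
  have "bij_betw ?\<mu> (carrier units_semidirect) ?P"
  proof (rule bij_betw_byWitness[where f' = "\<lambda>u. (u * fls_const (inverse (fls_nth u 0)), fls_nth u 0)"])
    show "\<forall>x\<in>carrier units_semidirect.
        (?\<mu> x * fls_const (inverse (fls_nth (?\<mu> x) 0)), fls_nth (?\<mu> x) 0) = x"
    proof
      fix x :: "'a fls \<times> 'a" assume x: "x \<in> carrier units_semidirect"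
      obtain w c where wc: "x = (w, c)" by force
      have "0 < c" using x by (simp add: wc units_semidirect_carrier)
      then show "(?\<mu> x * fls_const (inverse (fls_nth (?\<mu> x) 0)), fls_nth (?\<mu> x) 0) = x"
        using product(2)[OF x[unfolded wc]] by (simp add: wc mult.assoc)
    qed
    show "\<forall>u\<in>?P. ?\<mu> (u * fls_const (inverse (fls_nth u 0)), fls_nth u 0) = u"
    proof
      fix u assume "u \<in> ?P"
      then have "0 < fls_nth u 0" using U_pos_iff[of u] by auto
      then show "?\<mu> (u * fls_const (inverse (fls_nth u 0)), fls_nth u 0) = u"
        by (simp add: mult.assoc)
    qed
    show "?\<mu> ` carrier units_semidirect \<subseteq> ?P"
      using product(1) by auto
    show "(\<lambda>u. (u * fls_const (inverse (fls_nth u 0)), fls_nth u 0)) ` ?P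
            \<subseteq> carrier units_semidirect"
    proof (rule image_subsetI)
      fix u assume u: "u \<in> ?P"
      then have c: "0 < fls_nth u 0" using U_pos_iff[of u] by auto
      let ?w = "u * fls_const (inverse (fls_nth u 0))"
      from c have "0 < inverse (fls_nth u 0)" by simp
      from times_s_U_pos[OF _ _ fls_const_U_pos[OF this], of u] have "?w \<in> U_fls" "0 < ?w"
        using u unfolding times_s_const by auto
      then show "(?w, fls_nth u 0) \<in> carrier units_semidirect"
        using c by (simp add: units_semidirect_carrier one_units_iff)
    qed
  qed
  moreover have "bij_betw sigma ?P (carrier o_Aut_fix)"
    using inj_on_sigma by (auto simp: o_Aut_fix_carrier_eq bij_betw_def intro: inj_on_subset)
  ultimately have "bij_betw (sigma \<circ> ?\<mu>) (carrier units_semidirect) (carrier o_Aut_fix)"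
    by (rule bij_betw_trans)
  moreover have "(sigma \<circ> ?\<mu>) x = (\<lambda>(w, c). sigma w \<circ> sigma (fls_const c)) x"
    if "x \<in> carrier units_semidirect" for x
  proof -
    obtain w c where wc: "x = (w, c)" by force
    have "w \<in> U_fls" "0 < c"
      using that by (auto simp: wc units_semidirect_carrier one_units_iff)
    then have "sigma (times_s w (fls_const c)) = sigma w \<circ> sigma (fls_const c)"
      by (intro sigma_times_s fls_const_U_pos)
    then show ?thesis by (simp add: wc times_s_const)
  qed
  ultimately show ?thesis by (simp cong: bij_betw_cong)
qed

section \<open>Automorphisms stabilizing the coefficients\<close>

lemma coeff_map_const: "\<rho> 0 = 0 \<Longrightarrow> coeff_map \<rho> (fls_const c) = fls_const (\<rho> c)"
  by (intro fls_eqI) (simp add: fls_nth_coeff_map)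

lemma o_Aut_sum:
  assumes "\<rho> \<in> carrier o_Aut" shows "\<rho> (sum g A) = (\<Sum>i\<in>A. \<rho> (g i))"
  by (induction A rule: infinite_finite_induct) (simp_all add: o_Aut_0[OF assms] o_Aut_add[OF assms])

lemma fls_subdegree_coeff_map:
  assumes "\<rho> \<in> carrier o_Aut" shows "fls_subdegree (coeff_map \<rho> a) = fls_subdegree a"
proof (cases "a = 0")
  case True
  then have "coeff_map \<rho> a = 0"
    by (intro fls_eqI) (simp add: fls_nth_coeff_map o_Aut_0[OF assms])
  with True show ?thesis by simp
next
  case False
  then show ?thesis
    by (intro fls_subdegree_eqI) (simp_all add: fls_nth_coeff_map o_Aut_0[OF assms] o_Aut_eq_0_iff[OF assms])
qed

lemma coeff_map_comp:
  assumes "\<rho> \<in> carrier o_Aut" "\<tau> \<in> carrier o_Aut"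
  shows "coeff_map (\<rho> \<circ> \<tau>) = coeff_map \<rho> \<circ> coeff_map \<tau>"
  using assms by (intro ext fls_eqI) (simp add: fls_nth_coeff_map o_Aut_0)

lemma coeff_map_in_o_Aut_stab:
  fixes \<rho> :: "'a::linordered_field \<Rightarrow> 'a"
  assumes \<rho>: "\<rho> \<in> carrier o_Aut"
  shows "coeff_map \<rho> \<in> carrier o_Aut_stab"
proof -
  note nth = fls_nth_coeff_map[of \<rho>, OF o_Aut_0[OF \<rho>]]
  have id: "coeff_map id = id" by (intro ext fls_eqI) (simp add: fls_nth_coeff_map)
  have "\<rho> \<circ> inv_into UNIV \<rho> = id" "inv_into UNIV \<rho> \<circ> \<rho> = id"
    using bij_is_surj[OF o_Aut_bij[OF \<rho>]] bij_is_inj[OF o_Aut_bij[OF \<rho>]]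
    by (simp_all only: surj_iff inj_iff)
  then have "coeff_map \<rho> \<circ> coeff_map (inv_into UNIV \<rho>) = id"
    "coeff_map (inv_into UNIV \<rho>) \<circ> coeff_map \<rho> = id"
    by (simp_all flip: coeff_map_comp add: \<rho> o_Aut_inv id)
  then have "bij (coeff_map \<rho>)" by (rule o_bij[rotated])
  moreover have add: "coeff_map \<rho> (a + b) = coeff_map \<rho> a + coeff_map \<rho> b" for a b
    by (intro fls_eqI) (simp add: nth o_Aut_add[OF \<rho>])
  moreover have diff: "coeff_map \<rho> (a - b) = coeff_map \<rho> a - coeff_map \<rho> b" for a b
    by (intro fls_eqI) (simp add: nth o_Aut_diff[OF \<rho>])
  moreover have "coeff_map \<rho> (a * b) = coeff_map \<rho> a * coeff_map \<rho> b" for a b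
    by (intro fls_eqI)
      (simp add: nth fls_times_nth(2) fls_subdegree_coeff_map[OF \<rho>] o_Aut_sum[OF \<rho>] o_Aut_mult[OF \<rho>])
  moreover have "coeff_map \<rho> 1 = 1"
    using coeff_map_const[of \<rho> 1] by (simp add: o_Aut_0[OF \<rho>] o_Aut_1[OF \<rho>])
  moreover have "coeff_map \<rho> a \<le> coeff_map \<rho> b" if "a \<le> b" for a b
    using that diff[of b a]
    by (auto simp: less_eq_fls_def fls_pos_def nth fls_subdegree_coeff_map[OF \<rho>] o_Aut_pos[OF \<rho>]
        simp flip: diff)
  moreover have "coeff_map \<rho> ` range fls_const = range fls_const"
  proof -
    have "coeff_map \<rho> ` range fls_const = fls_const ` range \<rho>"
      by (simp add: image_image coeff_map_const o_Aut_0[OF \<rho>])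
    then show ?thesis using bij_is_surj[OF o_Aut_bij[OF \<rho>]] by simp
  qed
  ultimately show ?thesis
    by (simp add: o_Aut_stab_carrier_iff o_Aut_carrier_iff mono_def)
qed

lemma restriction_in_o_Aut:
  fixes f :: "'a::linordered_field fls \<Rightarrow> 'a fls"
  assumes f: "f \<in> carrier o_Aut_stab"
  obtains \<rho> where "\<rho> \<in> carrier o_Aut" "\<And>c. f (fls_const c) = fls_const (\<rho> c)"
proof -
  have f': "f \<in> carrier o_Aut" and im: "f ` range fls_const = range fls_const"
    using f by (auto simp: o_Aut_stab_carrier_iff)
  from im have "\<forall>c. \<exists>d. f (fls_const c) = fls_const d" by blast
  then obtain \<rho> where \<rho>: "f (fls_const c) = fls_const (\<rho> c)" for c by metis
  have const_eq: "fls_const c = fls_const d \<Longrightarrow> c = d" for c d :: 'a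
    by (metis fls_const_nth)
  have const_le: "fls_const c \<le> fls_const d \<longleftrightarrow> c \<le> d" for c d :: 'a
    using fls_const_pos[of "d - c"] fls_const_pos[of "c - d"]
    by (cases c d rule: linorder_cases) (auto simp flip: fls_minus_const)
  have "inj \<rho>"
    by (rule injI) (metis \<rho> const_eq o_Aut_bij[OF f'] bij_is_inj injD)
  moreover have "surj \<rho>"
  proof -
    have "\<exists>c. d = \<rho> c" for d
    proof -
      have "fls_const d \<in> f ` range fls_const" using im by simp
      then obtain e where "fls_const d = fls_const (\<rho> e)" by (auto simp: \<rho>)
      then show ?thesis using const_eq by blast
    qed
    then show ?thesis by (simp add: surj_def)
  qed
  moreover have "\<rho> 1 = 1" by (rule const_eq) (simp flip: \<rho> add: o_Aut_1[OF f'])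
  moreover have "\<rho> (c + d) = \<rho> c + \<rho> d" for c d
    by (rule const_eq) (simp flip: \<rho> fls_plus_const add: o_Aut_add[OF f'])
  moreover have "\<rho> (c * d) = \<rho> c * \<rho> d" for c d
    by (rule const_eq) (simp flip: \<rho> fls_const_mult_const add: o_Aut_mult[OF f'])
  moreover have "\<rho> c \<le> \<rho> d" if "c \<le> d" for c d
    using o_Aut_mono[OF f', of "fls_const c" "fls_const d"] that by (simp add: \<rho> const_le)
  ultimately have "\<rho> \<in> carrier o_Aut" by (simp add: o_Aut_carrier_iff bij_def mono_def)
  then show ?thesis using \<rho> that by blast
qed

text \<open>The conjugate again fixes \<open>k\<close> pointwise, and every such order automorphism is some
  \<open>\<sigma>\<^sub>u\<close>. So the conjugate of \<open>\<sigma>\<^sub>u\<close> need not be computed on coefficients.\<close>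

lemma coeff_map_normalizes_o_Aut_fix:
  fixes \<rho> :: "'a::linordered_field \<Rightarrow> 'a"
  assumes \<rho>: "\<rho> \<in> carrier o_Aut" and f: "f \<in> carrier o_Aut_fix"
  shows "\<exists>g\<in>carrier o_Aut_fix. g \<circ> coeff_map \<rho> = coeff_map \<rho> \<circ> f"
proof -
  have cm: "coeff_map \<rho> \<in> carrier o_Aut"
    using coeff_map_in_o_Aut_stab[OF \<rho>] by (simp add: o_Aut_stab_carrier_iff)
  have f': "f \<in> carrier o_Aut" "\<And>c. f (fls_const c) = fls_const c"
    using f by (auto simp: o_Aut_fix_carrier_iff)
  define g where "g = coeff_map \<rho> \<circ> f \<circ> inv_into UNIV (coeff_map \<rho>)"
  have g_comp: "g \<circ> coeff_map \<rho> = coeff_map \<rho> \<circ> f"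
    using o_Aut_bij[OF cm] by (simp add: g_def fun_eq_iff bij_is_inj)
  have "g (fls_const c) = fls_const c" for c
  proof -
    obtain d where d: "c = \<rho> d" using bij_is_surj[OF o_Aut_bij[OF \<rho>]] by (auto simp: surj_def)
    have "g (coeff_map \<rho> (fls_const d)) = coeff_map \<rho> (f (fls_const d))"
      using fun_cong[OF g_comp, of "fls_const d"] by simp
    then show ?thesis by (simp add: d f'(2) coeff_map_const o_Aut_0[OF \<rho>])
  qed
  moreover have "g \<in> carrier o_Aut"
    unfolding g_def by (intro o_Aut_comp o_Aut_inv cm f'(1))
  ultimately show ?thesis using g_comp by (auto simp: o_Aut_fix_carrier_iff)
qed

lemma o_Aut_stab_decompose:
  fixes f :: "'a::linordered_field fls \<Rightarrow> 'a fls"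
  assumes f: "f \<in> carrier o_Aut_stab"
  obtains g \<rho> where "g \<in> carrier o_Aut_fix" "\<rho> \<in> carrier o_Aut" "f = g \<circ> coeff_map \<rho>"
proof -
  obtain \<rho> where \<rho>: "\<rho> \<in> carrier o_Aut" and f\<rho>: "\<And>c. f (fls_const c) = fls_const (\<rho> c)"
    using restriction_in_o_Aut[OF f] by blast
  have cm: "coeff_map \<rho> \<in> carrier o_Aut"
    using coeff_map_in_o_Aut_stab[OF \<rho>] by (simp add: o_Aut_stab_carrier_iff)
  define g where "g = f \<circ> inv_into UNIV (coeff_map \<rho>)"
  have f_eq: "f = g \<circ> coeff_map \<rho>"
    using o_Aut_bij[OF cm] by (simp add: g_def fun_eq_iff bij_is_inj)
  have "g (fls_const c) = fls_const c" for c
  proof -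
    obtain d where d: "c = \<rho> d" using bij_is_surj[OF o_Aut_bij[OF \<rho>]] by (auto simp: surj_def)
    have "g (coeff_map \<rho> (fls_const d)) = f (fls_const d)"
      using fun_cong[OF f_eq, of "fls_const d"] by simp
    then show ?thesis by (simp add: d f\<rho> coeff_map_const o_Aut_0[OF \<rho>])
  qed
  moreover have "g \<in> carrier o_Aut"
    using f unfolding g_def by (intro o_Aut_comp o_Aut_inv cm) (simp add: o_Aut_stab_carrier_iff)
  ultimately have "g \<in> carrier o_Aut_fix" by (simp add: o_Aut_fix_carrier_iff)
  then show ?thesis using \<rho> f_eq that by blast
qed

text \<open>The coefficient part is unique because it is the restriction to \<open>k\<close>.\<close>

lemma o_Aut_stab_decompose_unique:
  fixes \<rho> \<tau> :: "'a::linordered_field \<Rightarrow> 'a"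
  assumes f: "f \<in> carrier o_Aut_fix" and g: "g \<in> carrier o_Aut_fix"
    and \<rho>: "\<rho> \<in> carrier o_Aut" and \<tau>: "\<tau> \<in> carrier o_Aut"
    and eq: "f \<circ> coeff_map \<rho> = g \<circ> coeff_map \<tau>"
  shows "f = g \<and> \<rho> = \<tau>"
proof -
  have "fls_const (\<rho> c) = fls_const (\<tau> c)" for c
    using fun_cong[OF eq, of "fls_const c"] f g
    by (simp add: coeff_map_const o_Aut_0[OF \<rho>] o_Aut_0[OF \<tau>] o_Aut_fix_carrier_iff)
  then have "\<rho> = \<tau>" by (metis ext fls_const_nth)
  moreover have "surj (coeff_map \<rho>)"
    using coeff_map_in_o_Aut_stab[OF \<rho>] bij_is_surj[OF o_Aut_bij]
    by (auto simp only: o_Aut_stab_carrier_iff)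
  ultimately show ?thesis using eq by (metis surj_fun_eq fun_eq_iff)
qed

lemma o_Aut_stab_iso: "(o_Aut_stab :: ('a::linordered_field fls \<Rightarrow> 'a fls) monoid) \<cong>
    (full_semidirect :: (('a fls \<times> 'a) \<times> ('a \<Rightarrow> 'a)) monoid)"
proof (rule is_iso_by_parametrization)
  let ?i = "\<lambda>(w, c). sigma w \<circ> sigma (fls_const c) :: 'a fls \<Rightarrow> 'a fls"
  let ?\<phi> = "\<lambda>(n, \<rho>). ?i n \<circ> coeff_map \<rho>"
  have inj: "inj_on ?i (carrier units_semidirect)"
    and im: "?i ` carrier units_semidirect = carrier o_Aut_fix"
    using units_semidirect_param by (auto simp: bij_betw_def)
  have fix_mem: "?i n \<in> carrier o_Aut_fix" if "n \<in> carrier units_semidirect" for n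
    using that im by blast
  have carrier: "carrier full_semidirect
      = carrier units_semidirect \<times> carrier (o_Aut :: ('a \<Rightarrow> 'a) monoid)"
    by (simp add: full_semidirect_def semidirect_def)
  show "bij_betw ?\<phi> (carrier full_semidirect) (carrier o_Aut_stab)"
    unfolding bij_betw_def
  proof (intro conjI equalityI subsetI)
    show "inj_on ?\<phi> (carrier full_semidirect)"
    proof (rule inj_onI)
      fix x y assume x: "x \<in> carrier full_semidirect" and y: "y \<in> carrier full_semidirect"
        and eq: "?\<phi> x = ?\<phi> y"
      obtain m \<rho> where x': "x = (m, \<rho>)" by (cases x)
      obtain n \<tau> where y': "y = (n, \<tau>)" by (cases y)
      have mem: "m \<in> carrier units_semidirect" "n \<in> carrier units_semidirect"
        "\<rho> \<in> carrier o_Aut" "\<tau> \<in> carrier o_Aut"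
        using x y by (auto simp: x' y' carrier)
      have "?i m \<circ> coeff_map \<rho> = ?i n \<circ> coeff_map \<tau>" using eq by (simp add: x' y')
      then have "?i m = ?i n \<and> \<rho> = \<tau>"
        using mem fix_mem by (intro o_Aut_stab_decompose_unique)
      then show "x = y" using inj mem by (auto simp: x' y' dest: inj_onD)
    qed
  next
    fix f assume "f \<in> ?\<phi> ` carrier full_semidirect"
    then obtain n \<rho> where f: "f = ?i n \<circ> coeff_map \<rho>"
      and mem: "n \<in> carrier units_semidirect" "\<rho> \<in> carrier o_Aut"
      unfolding carrier by force
    have i: "?i n \<in> carrier o_Aut" "\<And>c. ?i n (fls_const c) = fls_const c"
      using fix_mem[OF mem(1)] by (auto simp: o_Aut_fix_carrier_iff)
    have cm: "coeff_map \<rho> \<in> carrier o_Aut" "coeff_map \<rho> ` range fls_const = range fls_const"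
      using coeff_map_in_o_Aut_stab[OF mem(2)] by (auto simp: o_Aut_stab_carrier_iff)
    have "?i n ` range fls_const = range fls_const" using i(2) by (simp add: image_image)
    then have "f ` range fls_const = range fls_const"
      unfolding f image_comp[symmetric] cm(2) .
    then show "f \<in> carrier o_Aut_stab"
      using i(1) cm(1) unfolding o_Aut_stab_carrier_iff f by (simp add: o_Aut_comp)
  next
    fix f :: "'a fls \<Rightarrow> 'a fls" assume "f \<in> carrier o_Aut_stab"
    then obtain g \<rho> where g: "g \<in> carrier o_Aut_fix" "\<rho> \<in> carrier o_Aut" "f = g \<circ> coeff_map \<rho>"
      by (rule o_Aut_stab_decompose)
    then obtain n where "n \<in> carrier units_semidirect" "g = ?i n" using im by blast
    then have "(n, \<rho>) \<in> carrier full_semidirect" "f = ?\<phi> (n, \<rho>)" using g by (auto simp: carrier)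
    then show "f \<in> ?\<phi> ` carrier full_semidirect" by blast
  qed
  fix x y :: "('a fls \<times> 'a) \<times> ('a \<Rightarrow> 'a)"
  assume xy: "x \<in> carrier full_semidirect" "y \<in> carrier full_semidirect"
  have "x \<otimes>\<^bsub>full_semidirect\<^esub> y \<in> carrier full_semidirect \<and>
        ?\<phi> (x \<otimes>\<^bsub>full_semidirect\<^esub> y) = ?\<phi> x \<circ> ?\<phi> y"
    unfolding full_semidirect_def
  proof (rule semidirect_mult)
    fix \<rho> :: "'a \<Rightarrow> 'a" assume \<rho>: "\<rho> \<in> carrier o_Aut"
    show "bij (coeff_map \<rho>)"
      using coeff_map_in_o_Aut_stab[OF \<rho>] by (auto simp: o_Aut_stab_carrier_iff intro: o_Aut_bij)
    show "\<exists>m\<in>carrier units_semidirect. ?i m \<circ> coeff_map \<rho> = coeff_map \<rho> \<circ> ?i n"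
      if "n \<in> carrier units_semidirect" for n
      using coeff_map_normalizes_o_Aut_fix[OF \<rho> fix_mem[OF that]] im by (metis (lifting) imageE)
    show "\<rho> \<otimes>\<^bsub>o_Aut\<^esub> \<tau> \<in> carrier o_Aut \<and>
          coeff_map (\<rho> \<otimes>\<^bsub>o_Aut\<^esub> \<tau>) = coeff_map \<rho> \<circ> coeff_map \<tau>" if "\<tau> \<in> carrier o_Aut" for \<tau>
    proof -
      have "\<rho> \<otimes>\<^bsub>o_Aut\<^esub> \<tau> = \<rho> \<circ> \<tau>" by (simp add: o_Aut_def)
      then show ?thesis using o_Aut_comp[OF \<rho> that] coeff_map_comp[OF \<rho> that] by simp
    qed
  qed (use inj units_semidirect_mult xy in \<open>auto simp: full_semidirect_def\<close>)
  then show "x \<otimes>\<^bsub>full_semidirect\<^esub> y \<in> carrier full_semidirect \<and>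
        ?\<phi> (x \<otimes>\<^bsub>full_semidirect\<^esub> y) = ?\<phi> x \<otimes>\<^bsub>o_Aut_stab\<^esub> ?\<phi> y"
    by (simp add: o_Aut_stab_def o_Aut_def)
qed

lemma o_Aut_fix_iso: "(o_Aut_fix :: ('a::linordered_field fls \<Rightarrow> 'a fls) monoid) \<cong>
    (U_pos_group :: 'a fls monoid)"
proof (rule is_iso_by_parametrization)
  show "bij_betw sigma (carrier U_pos_group)
          (carrier (o_Aut_fix :: ('a fls \<Rightarrow> 'a fls) monoid))"
    using inj_on_sigma
    by (auto simp: o_Aut_fix_carrier_eq U_pos_group_def bij_betw_def intro: inj_on_subset)
qed (simp add: U_pos_group_def o_Aut_fix_def o_Aut_def times_s_U_pos sigma_times_s)

theorem corollary5p2p7: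
  shows "carrier (o_Aut_fix :: ('a::linordered_field fls \<Rightarrow> 'a fls) monoid)
           = sigma ` {u \<in> U_fls. u > 0} \<and>
         (o_Aut_fix :: ('a fls \<Rightarrow> 'a fls) monoid) \<cong> (U_pos_group :: 'a fls monoid) \<and>
         (o_Aut_stab :: ('a fls \<Rightarrow> 'a fls) monoid)
           \<cong> (full_semidirect :: (('a fls \<times> 'a) \<times> ('a \<Rightarrow> 'a)) monoid)"
  using o_Aut_fix_carrier_eq o_Aut_fix_iso o_Aut_stab_iso by blast

end
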